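(* Let $n \ge 1$. For any Gallai coloring of the complete graph $K_n$ on the vertex set $\{1, 2, \dots, n\}$, with $d(i)$ denoting the color degree of vertex $i$, the following inequality holds: \[ \sum_{i=1}^n \frac{1}{2^{d(i)}} \ge 1. \]
   Context: A Gallai coloring of the complete graph $K_n$ is an assignment of a color to each edge (with no restriction on the number of colors, and not necessarily proper) such that there is no rainbow (tricolored) triangle, i.e. no triangle whose three edges have three pairwise distinct colors. The color degree $d(i)$ of a vertex $i$ is the number of distinct colors appearing on the edges incident to $i$. *)

theory Defs
  imports Complex_Main "HOL-Library.Ramsey"
begin

text \<open>
  The edges of the complete graph on \<open>V\<close> are the two-element subsets of \<open>V\<close>, i.e. the members of
  \<open>nsets V 2\<close>. An edge colouring is a function on sets of vertices with values in an arbitrary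
  type of colours; its values on sets that are not edges are irrelevant and never used below.
\<close>

definition rainbow_triangle :: "'v set \<Rightarrow> ('v set \<Rightarrow> 'c) \<Rightarrow> 'v \<Rightarrow> 'v \<Rightarrow> 'v \<Rightarrow> bool" where
  "rainbow_triangle V c x y z \<longleftrightarrow>
     x \<in> V \<and> y \<in> V \<and> z \<in> V \<and> x \<noteq> y \<and> y \<noteq> z \<and> x \<noteq> z \<and>
     c {x, y} \<noteq> c {y, z} \<and> c {y, z} \<noteq> c {x, z} \<and> c {x, y} \<noteq> c {x, z}"

definition gallai_coloring :: "'v set \<Rightarrow> ('v set \<Rightarrow> 'c) \<Rightarrow> bool" where
  "gallai_coloring V c \<longleftrightarrow> (\<nexists>x y z. rainbow_triangle V c x y z)"

definition color_degree :: "'v set \<Rightarrow> ('v set \<Rightarrow> 'c) \<Rightarrow> 'v \<Rightarrow> nat" where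
  "color_degree V c v = card (c ` {e \<in> nsets V 2. v \<in> e})"

end

theory Submission
  imports Defs
begin

text \<open>
  Call \<open>M \<subseteq> V\<close> a module if every vertex outside \<open>M\<close> sees \<open>M\<close> in a single colour. Contracting a
  module \<open>M\<close> to one of its vertices \<open>m\<close> gives the induced colouring on \<open>(V - M) \<union> {m}\<close>, and
  every vertex of \<open>M\<close> has degree at most its degree inside \<open>M\<close> plus the degree of \<open>m\<close> after the
  contraction. So the inequality for \<open>V\<close> follows by induction from those for \<open>M\<close> and for
  \<open>(V - M) \<union> {m}\<close>. In a Gallai colouring the connected components of each colour class are
  modules, and if three or more colours occur then some occurring colour is disconnected. Hence
  a colouring without nontrivial modules uses at most two colours, all degrees are at most 2, and
  four vertices already contribute 1 to the sum; fewer vertices are handled directly.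
\<close>

section \<open>Modules and colour components\<close>

definition hmodule :: "'v set \<Rightarrow> ('v set \<Rightarrow> 'c) \<Rightarrow> 'v set \<Rightarrow> bool" where
  "hmodule V c M \<longleftrightarrow> M \<subseteq> V \<and> (\<forall>x\<in>M. \<forall>y\<in>M. \<forall>z\<in>V - M. c {x, z} = c {y, z})"

definition color_rel :: "'v set \<Rightarrow> ('v set \<Rightarrow> 'c) \<Rightarrow> 'c \<Rightarrow> ('v \<times> 'v) set" where
  "color_rel V c k = {(x, y). x \<in> V \<and> y \<in> V \<and> x \<noteq> y \<and> c {x, y} = k}"

text \<open>The closure is reflexive, so a vertex without edges of colour \<open>k\<close> is its
  own component; a colour absent from \<open>V\<close> has singleton components.\<close>

definition color_component :: "'v set \<Rightarrow> ('v set \<Rightarrow> 'c) \<Rightarrow> 'c \<Rightarrow> 'v \<Rightarrow> 'v set" where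
  "color_component V c k x = (color_rel V c k)\<^sup>* `` {x}"

lemma hmoduleD:
  "hmodule V c M \<Longrightarrow> x \<in> M \<Longrightarrow> y \<in> M \<Longrightarrow> z \<in> V \<Longrightarrow> z \<notin> M \<Longrightarrow> c {x, z} = c {y, z}"
  unfolding hmodule_def by blast

lemma gallai_coloring_subset:
  "gallai_coloring V c \<Longrightarrow> W \<subseteq> V \<Longrightarrow> gallai_coloring W c"
  unfolding gallai_coloring_def rainbow_triangle_def by blast

lemma gallai_coloringD:
  assumes "gallai_coloring V c" "x \<in> V" "y \<in> V" "z \<in> V" "x \<noteq> y" "y \<noteq> z" "x \<noteq> z"
  shows "c {x, y} = c {y, z} \<or> c {y, z} = c {x, z} \<or> c {x, y} = c {x, z}"
  using assms unfolding gallai_coloring_def rainbow_triangle_def by blast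

lemma color_component_refl: "x \<in> color_component V c k x"
  by (simp add: color_component_def)

text \<open>Serves to bound components from above: disconnectedness is always shown by naming a set
  that no edge of colour \<open>k\<close> leaves.\<close>

lemma color_component_closed:
  assumes "y \<in> C" "\<And>u w. u \<in> C \<Longrightarrow> u \<in> V \<Longrightarrow> w \<in> V \<Longrightarrow> w \<notin> C \<Longrightarrow> c {u, w} \<noteq> k"
  shows "color_component V c k y \<subseteq> C"
proof
  fix z assume "z \<in> color_component V c k y"
  then have "(y, z) \<in> (color_rel V c k)\<^sup>*" by (simp add: color_component_def)
  then show "z \<in> C"
    by (induction rule: rtrancl_induct) (use assms in \<open>auto simp: color_rel_def\<close>)
qed

lemma color_component_subset:
  assumes "x \<in> V"
  shows "color_component V c k x \<subseteq> V"
  using assms by (intro color_component_closed) auto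

lemma color_component_step:
  "u \<in> color_component V c k x \<Longrightarrow> u \<in> V \<Longrightarrow> w \<in> V \<Longrightarrow> u \<noteq> w \<Longrightarrow> c {u, w} = k
    \<Longrightarrow> w \<in> color_component V c k x"
  by (auto simp: color_component_def color_rel_def intro: rtrancl_into_rtrancl)

lemma color_component_eq:
  assumes "y \<in> color_component V c k x"
  shows "color_component V c k y = color_component V c k x"
proof -
  have "sym ((color_rel V c k)\<^sup>*)"
    by (intro sym_rtrancl) (auto simp: sym_def color_rel_def insert_commute)
  then show ?thesis
    using assms unfolding color_component_def by (auto dest: symD intro: rtrancl_trans)
qed

text \<open>Walk from \<open>x\<close> to \<open>y\<close> along edges of colour \<open>k\<close>.
  No edge from the walk to \<open>z\<close> has colour \<open>k\<close>, since \<open>z\<close> lies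
  outside the component; so in the triangle of a step \<open>u\<close>, \<open>w\<close> with
  \<open>z\<close> the two edges at \<open>z\<close> must agree.\<close>

lemma hmodule_color_component:
  assumes "gallai_coloring V c" "x \<in> V"
  shows "hmodule V c (color_component V c k x)"
proof -
  let ?C = "color_component V c k x"
  have "c {x, z} = c {y, z}" if y: "y \<in> ?C" and z: "z \<in> V" "z \<notin> ?C" for y z
  proof -
    have "(x, y) \<in> (color_rel V c k)\<^sup>*" using y by (simp add: color_component_def)
    then show ?thesis
    proof (induction rule: rtrancl_induct)
      case (step u w)
      have u: "u \<in> ?C" using step.hyps by (simp add: color_component_def)
      have uw: "u \<in> V" "w \<in> V" "u \<noteq> w" "c {u, w} = k" using step.hyps by (auto simp: color_rel_def)
      have w: "w \<in> ?C" using color_component_step[OF u uw] .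
      have "c {u, z} \<noteq> k" "c {w, z} \<noteq> k"
        using color_component_step[OF u uw(1) z(1)] color_component_step[OF w uw(2) z(1)] u w z
        by auto
      moreover have "u \<noteq> z" "w \<noteq> z" using u w z by auto
      ultimately have "c {u, z} = c {w, z}"
        using gallai_coloringD[OF assms(1) uw(1,2) z(1) uw(3)] uw(4) by metis
      then show ?case using step.IH by simp
    qed simp
  qed
  then show ?thesis
    unfolding hmodule_def using color_component_subset[OF assms(2)] by (metis Diff_iff)
qed

section \<open>Three colours force a disconnected one\<close>

lemma color_of_edge:
  assumes "x \<in> V" "y \<in> V" "x \<noteq> y"
  shows "c {x, y} \<in> c ` nsets V 2"
  using assms by (auto simp: nsets_def)

lemma edge_of_color:
  assumes "k \<in> c ` nsets V 2"
  obtains x y where "x \<in> V" "y \<in> V" "x \<noteq> y" "c {x, y} = k"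
  using assms by (auto simp: nsets_def card_2_iff)

text \<open>
  A colour disconnected after deleting \<open>v\<close> reconnects only through \<open>v\<close>, which therefore sends an
  edge of that colour into each component. This pins down all other colours at \<open>v\<close>.
\<close>

lemma disconnected_color_extend:
  assumes g: "gallai_coloring V c"
    and three: "\<And>b. \<not> c ` nsets V 2 \<subseteq> {k, b}"
    and v: "v \<in> V" and x: "x \<in> V - {v}"
    and disc: "color_component (V - {v}) c k x \<noteq> V - {v}"
    and k: "k \<in> c ` nsets V 2"
  shows "\<exists>k'\<in>c ` nsets V 2. \<exists>x'\<in>V. color_component V c k' x' \<noteq> V"
proof (rule ccontr)
  assume "\<not> ?thesis"
  then have conn: "color_component V c k' x' = V" if "k' \<in> c ` nsets V 2" "x' \<in> V" for k' x'
    using that by blast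
  define W where "W = V - {v}"
  have gW: "gallai_coloring W c" using gallai_coloring_subset[OF g] by (auto simp: W_def)
  let ?C = "color_component W c k"
  have CW: "?C y \<subseteq> W" if "y \<in> W" for y using that by (rule color_component_subset)
  have touch: "\<exists>u\<in>?C y. c {v, u} = k" if y: "y \<in> W" for y
  proof (rule ccontr)
    assume no: "\<not> ?thesis"
    have "color_component V c k y \<subseteq> ?C y"
    proof (rule color_component_closed)
      fix u w assume u: "u \<in> ?C y" and w: "w \<in> V" "w \<notin> ?C y"
      have "u \<in> W" using u CW[OF y] by auto
      show "c {u, w} \<noteq> k"
      proof (cases "w = v")
        case True
        then show ?thesis using no u by (auto simp: insert_commute)
      next
        case False
        then have "w \<in> W" using w by (simp add: W_def)
        then show ?thesis using color_component_step[OF u \<open>u \<in> W\<close>] u w by metis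
      qed
    qed (rule color_component_refl)
    then show False using conn[OF k] y v CW[OF y] by (auto simp: W_def)
  qed
  \<comment> \<open>Otherwise \<open>v\<close> would be isolated in every other occurring colour
    \<open>b\<close>, against the connectedness of \<open>b\<close>.\<close>
  have "\<exists>y\<in>W. c {v, y} \<noteq> k"
  proof (rule ccontr)
    assume "\<not> ?thesis"
    then have all: "c {v, y} = k" if "y \<in> W" for y using that by auto
    obtain b where b: "b \<in> c ` nsets V 2" "b \<noteq> k" using three by blast
    have "color_component V c b v \<subseteq> {v}"
      by (rule color_component_closed) (use all b in \<open>auto simp: W_def\<close>)
    then show False using conn[OF b(1) v] x by auto
  qed
  then obtain y where y: "y \<in> W" "c {v, y} \<noteq> k" by auto
  define b where "b = c {v, y}"
  have "?C y \<noteq> W"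
    using disc color_component_eq[of x W c k y] x by (auto simp: W_def)
  \<comment> \<open>The claim below about edges to \<open>v\<close> does not mention
    \<open>z\<close>, but its proof needs a second component; \<open>z0\<close> supplies
    one.\<close>
  then obtain z0 where "z0 \<in> W" "z0 \<notin> ?C y" using CW[OF y(1)] by auto
  \<comment> \<open>The aim is that only \<open>k\<close> and \<open>b\<close> occur on edges
    leaving \<open>?C y\<close> in \<open>V\<close>.\<close>
  have across: "(\<forall>y'\<in>?C y. c {v, y'} \<noteq> k \<longrightarrow> c {v, y'} = b)
      \<and> (\<forall>y'\<in>?C y. c {y', z} = b)" if z: "z \<in> W" "z \<notin> ?C y" for z
  proof -
    obtain u where u: "u \<in> ?C z" "c {v, u} = k" using touch[OF z(1)] by auto
    have uW: "u \<in> W" using u CW[OF z(1)] by auto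
    have Cu: "?C u = ?C z" using color_component_eq[OF u(1)] .
    have disj: "y' \<notin> ?C z" if "y' \<in> ?C y" for y'
      using color_component_eq[of y' W c k] that z color_component_refl by metis
    have uy: "u \<notin> ?C y" using disj u by auto
    \<comment> \<open>In the triangle \<open>v\<close>, \<open>u\<close>, \<open>y'\<close> only
      \<open>{v, u}\<close> has colour \<open>k\<close>, so the other two edges agree.\<close>
    have *: "c {u, y'} = c {v, y'}" if y': "y' \<in> ?C y" "c {v, y'} \<noteq> k" for y'
    proof -
      have "y' \<in> W" using y' CW[OF y(1)] by auto
      moreover have "u \<noteq> y'" using uy y' by auto
      moreover have "c {u, y'} \<noteq> k"
        using color_component_step[of u W c k z y'] u uW disj[OF y'(1)] \<open>y' \<in> W\<close> \<open>u \<noteq> y'\<close>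
        by auto
      ultimately show ?thesis
        using gallai_coloringD[OF g v, of u y'] uW u(2) y'(2) by (auto simp: W_def)
    qed
    \<comment> \<open>Both components are modules of \<open>W\<close>, so all edges between them
      share one colour, that of \<open>{u, y}\<close>, which is \<open>b\<close>.\<close>
    have modz: "c {z, y'} = c {u, y'}" if "y' \<in> ?C y" for y'
      using hmoduleD[OF hmodule_color_component[OF gW z(1)], of z k u y'] u(1) disj[OF that] that
        CW[OF y(1)] color_component_refl by fastforce
    have mody: "c {y', w} = c {y, w}" if "y' \<in> ?C y" "w \<in> W" "w \<notin> ?C y" for y' w
      using hmoduleD[OF hmodule_color_component[OF gW y(1)] that(1) _ that(2,3)]
        color_component_refl by fastforce
    have uyb: "c {u, y} = b" using *[OF color_component_refl] y by (simp add: b_def)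
    have "c {v, y'} = b" if "y' \<in> ?C y" "c {v, y'} \<noteq> k" for y'
      using *[OF that] mody[OF that(1) uW uy] uyb by (simp add: insert_commute)
    moreover have "c {y', z} = b" if "y' \<in> ?C y" for y'
      using modz[OF that] mody[OF that uW uy] uyb by (simp add: insert_commute)
    ultimately show ?thesis by blast
  qed
  \<comment> \<open>A third colour cannot leave \<open>?C y\<close>, so it is disconnected in
    \<open>V\<close>: the contradiction.\<close>
  obtain t where t: "t \<in> c ` nsets V 2" "t \<noteq> k" "t \<noteq> b" using three[of b] by blast
  have "color_component V c t y \<subseteq> ?C y"
  proof (rule color_component_closed)
    fix u w assume u: "u \<in> ?C y" and w: "w \<in> V" "w \<notin> ?C y"
    show "c {u, w} \<noteq> t"
    proof (cases "w = v")
      case True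
      then show ?thesis
        using across[OF \<open>z0 \<in> W\<close> \<open>z0 \<notin> ?C y\<close>] u t by (metis insert_commute)
    next
      case False
      then have "w \<in> W" using w by (simp add: W_def)
      then show ?thesis using across[OF _ w(2)] u t by metis
    qed
  qed (rule color_component_refl)
  then show False using conn[OF t(1)] y v CW[OF y(1)] by (auto simp: W_def)
qed

text \<open>Delete a vertex \<open>v\<close>. Some colour of \<open>V\<close> is disconnected on the
  rest, by induction if three colours remain there and otherwise because a colour was lost.
  \<open>disconnected_color_extend\<close> then carries this back to \<open>V\<close>.\<close>

lemma exists_disconnected_color:
  assumes "finite V" "gallai_coloring V c" "card (c ` nsets V 2) \<ge> 3"
  shows "\<exists>k\<in>c ` nsets V 2. \<exists>x\<in>V. color_component V c k x \<noteq> V"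
  using assms
proof (induction V rule: finite_psubset_induct)
  case (psubset V)
  have three: "\<not> c ` nsets V 2 \<subseteq> {k, b}" for k b
  proof
    assume "c ` nsets V 2 \<subseteq> {k, b}"
    then have "card (c ` nsets V 2) \<le> card {k, b}" by (intro card_mono) auto
    also have "\<dots> \<le> 2" by (simp add: card_insert_if)
    finally show False using psubset.prems(2) by simp
  qed
  have "card V \<ge> 3"
  proof (rule ccontr)
    assume "\<not> ?thesis"
    then have "card V = 0 \<or> card V = 1 \<or> card V = 2" by linarith
    then have "card V choose 2 \<le> 1" by (auto simp: choose_two)
    moreover have "card (c ` nsets V 2) \<le> card V choose 2"
      using card_image_le[of "nsets V 2" c] finite_imp_finite_nsets[OF psubset.hyps]
      by (simp add: card_nsets)
    ultimately show False using psubset.prems(2) by simp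
  qed
  then have "V \<noteq> {}" by auto
  then obtain v where v: "v \<in> V" by blast
  define W where "W = V - {v}"
  have W: "W \<subset> V" "finite W" "card W \<ge> 2"
    using v psubset.hyps \<open>card V \<ge> 3\<close> by (auto simp: W_def)
  have sub: "c ` nsets W 2 \<subseteq> c ` nsets V 2" using W by (auto simp: nsets_def)
  have "\<exists>k\<in>c ` nsets V 2. \<exists>x\<in>W. color_component W c k x \<noteq> W"
  proof (cases "card (c ` nsets W 2) \<ge> 3")
    case True
    then show ?thesis
      using psubset.IH[OF W(1) gallai_coloring_subset[OF psubset.prems(1)]] W sub by blast
  next
    case False
    then have "c ` nsets W 2 \<noteq> c ` nsets V 2" using psubset.prems(2) by auto
    then obtain k where k: "k \<in> c ` nsets V 2" "k \<notin> c ` nsets W 2" using sub by blast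
    have "W \<noteq> {}" using W(3) by auto
    then obtain x where x: "x \<in> W" by blast
    \<comment> \<open>All edges of the lost colour \<open>k\<close> meet \<open>v\<close>, and
      \<open>W\<close> has at least two vertices.\<close>
    have "color_component W c k x \<subseteq> {x}"
    proof (rule color_component_closed)
      show "c {u, w} \<noteq> k" if "u \<in> {x}" "u \<in> W" "w \<in> W" "w \<notin> {x}" for u w
        using color_of_edge[of u W w c] k(2) that by auto
    qed simp
    moreover have "\<not> W \<subseteq> {x}" using W(3) card_mono[of "{x}" W] by auto
    ultimately show ?thesis using k x by auto
  qed
  then obtain k x where k: "k \<in> c ` nsets V 2" "x \<in> W" "color_component W c k x \<noteq> W" by auto
  show ?case
    by (rule disconnected_color_extend[OF psubset.prems(1) three v k(2,3)[unfolded W_def] k(1)])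
qed

section \<open>Colour degrees under contraction of a module\<close>

text \<open>Indexing by the other endpoint lets the colours at \<open>v\<close> be split along a
  partition of the vertices.\<close>

lemma color_degree_eq:
  assumes "v \<in> V"
  shows "color_degree V c v = card ((\<lambda>u. c {v, u}) ` (V - {v}))"
proof -
  have "{e \<in> nsets V 2. v \<in> e} = (\<lambda>u. {v, u}) ` (V - {v})"
    using assms by (auto simp: nsets_def card_2_iff image_iff)
  then show ?thesis by (simp add: color_degree_def image_image)
qed

lemma color_degree_less_card:
  assumes "finite V" "v \<in> V"
  shows "color_degree V c v < card V"
proof -
  have "color_degree V c v \<le> card (V - {v})"
    unfolding color_degree_eq[OF assms(2)] using assms by (intro card_image_le) auto
  also have "\<dots> < card V" using assms by (rule card_Diff1_less)
  finally show ?thesis .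
qed

text \<open>Seen from \<open>v\<close>, the module shows a single colour, and \<open>m\<close> alone
  still shows it.\<close>

lemma color_degree_contract_outside:
  assumes M: "hmodule V c M" and m: "m \<in> M" and v: "v \<in> V - M"
  shows "color_degree (insert m (V - M)) c v = color_degree V c v"
proof -
  obtain d where "\<And>x. x \<in> M \<Longrightarrow> c {v, x} = d"
    using hmoduleD[OF M _ m, of _ v] v by (metis DiffE insert_commute)
  then have "(\<lambda>u. c {v, u}) ` M = (\<lambda>u. c {v, u}) ` {m}"
    using m by auto
  moreover have "V - {v} = M \<union> (V - M - {v})" "insert m (V - M) - {v} = {m} \<union> (V - M - {v})"
    using M m v by (auto simp: hmodule_def)
  ultimately have "(\<lambda>u. c {v, u}) ` (insert m (V - M) - {v}) = (\<lambda>u. c {v, u}) ` (V - {v})"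
    by (simp only: image_Un)
  moreover have "v \<in> V" "v \<in> insert m (V - M)" using v by auto
  ultimately show ?thesis by (simp only: color_degree_eq)
qed

text \<open>Edges at \<open>v\<close> stay in \<open>M\<close> or leave it; the leaving ones carry
  the same colours as those at \<open>m\<close>. The two colour sets may overlap, hence only an
  inequality.\<close>

lemma color_degree_contract_inside:
  assumes M: "hmodule V c M" and m: "m \<in> M" and v: "v \<in> M"
  shows "color_degree V c v \<le> color_degree M c v + color_degree (insert m (V - M)) c m"
proof -
  have MV: "M \<subseteq> V" using M by (simp add: hmodule_def)
  have "(\<lambda>u. c {v, u}) ` (V - M) = (\<lambda>u. c {m, u}) ` (V - M)"
    using hmoduleD[OF M v m] by (intro image_cong) auto
  moreover have "insert m (V - M) - {m} = V - M" using m by auto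
  moreover have "V - {v} = (M - {v}) \<union> (V - M)" using MV v by auto
  ultimately have "(\<lambda>u. c {v, u}) ` (V - {v})
      = (\<lambda>u. c {v, u}) ` (M - {v}) \<union> (\<lambda>u. c {m, u}) ` (insert m (V - M) - {m})"
    by (simp only: image_Un)
  moreover have "v \<in> V" using MV v by auto
  ultimately show ?thesis
    using v by (simp only: color_degree_eq insertI1 card_Un_le)
qed

section \<open>The induction\<close>

lemma gallai_coloring_sum_ge_1:
  fixes c :: "'v set \<Rightarrow> 'c"
  assumes "finite V" "V \<noteq> {}" "gallai_coloring V c"
  shows "(\<Sum>v\<in>V. 1 / 2 ^ color_degree V c v) \<ge> (1 :: real)"
  using assms
proof (induction "card V" arbitrary: V rule: less_induct)
  case less
  note fin = less.prems(1) and g = less.prems(3)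
  show ?case
  \<comment> \<open>\<open>M \<noteq> V\<close> makes \<open>M\<close> smaller than
    \<open>V\<close>, and \<open>2 \<le> card M\<close> makes the contraction smaller, so induction
    applies to both.\<close>
  proof (cases "\<exists>M. hmodule V c M \<and> 2 \<le> card M \<and> M \<noteq> V")
    case True
    then obtain M where M: "hmodule V c M" "2 \<le> card M" "M \<noteq> V" by auto
    have MV: "M \<subset> V" using M by (auto simp: hmodule_def)
    have finM: "finite M" using MV fin by (auto intro: finite_subset)
    have "M \<noteq> {}" using M(2) by auto
    then obtain m where m: "m \<in> M" by blast
    define W where "W = insert m (V - M)"
    have WV: "W \<subseteq> V" using MV m by (auto simp: W_def)
    have "card W = Suc (card V - card M)"
      using MV m fin finM by (simp add: W_def card_Diff_subset)
    then have cW: "card W < card V" using M(2) psubset_card_mono[OF fin MV] by linarith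
    have sW: "(\<Sum>v\<in>W. 1 / 2 ^ color_degree W c v) \<ge> (1 :: real)"
      using less.hyps[OF cW] finite_subset[OF WV fin] gallai_coloring_subset[OF g WV]
      by (simp add: W_def)
    have sM: "(\<Sum>v\<in>M. 1 / 2 ^ color_degree M c v) \<ge> (1 :: real)"
      using less.hyps[OF psubset_card_mono[OF fin MV]] finM m gallai_coloring_subset[OF g] MV
      by blast
    let ?D = "color_degree W c m"
    \<comment> \<open>The weight of \<open>m\<close> in the contraction is spread over
      \<open>M\<close> in proportion to the weights inside \<open>M\<close>, whose sum is at least
      1.\<close>
    have "1 / 2 ^ ?D \<le> 1 / 2 ^ ?D * (\<Sum>v\<in>M. 1 / 2 ^ color_degree M c v :: real)"
      using mult_left_mono[OF sM, of "1 / 2 ^ ?D"] by simp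
    also have "\<dots> = (\<Sum>v\<in>M. 1 / 2 ^ (color_degree M c v + ?D))"
      by (simp add: sum_distrib_left power_add mult.commute)
    also have "\<dots> \<le> (\<Sum>v\<in>M. 1 / 2 ^ color_degree V c v)"
      using color_degree_contract_inside[OF M(1) m]
      by (intro sum_mono divide_left_mono power_increasing) (auto simp: W_def)
    finally have inM: "1 / 2 ^ ?D \<le> (\<Sum>v\<in>M. 1 / 2 ^ color_degree V c v :: real)" .
    have "(\<Sum>v\<in>W. 1 / 2 ^ color_degree W c v :: real)
        = 1 / 2 ^ ?D + (\<Sum>v\<in>V - M. 1 / 2 ^ color_degree W c v)"
      unfolding W_def using fin m by (subst sum.insert) auto
    also have "(\<Sum>v\<in>V - M. 1 / 2 ^ color_degree W c v :: real)
        = (\<Sum>v\<in>V - M. 1 / 2 ^ color_degree V c v)"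
      using color_degree_contract_outside[OF M(1) m] by (intro sum.cong) (auto simp: W_def)
    finally have "(\<Sum>v\<in>W. 1 / 2 ^ color_degree W c v :: real)
        \<le> (\<Sum>v\<in>M. 1 / 2 ^ color_degree V c v) + (\<Sum>v\<in>V - M. 1 / 2 ^ color_degree V c v)"
      using inM by linarith
    also have "\<dots> = (\<Sum>v\<in>V. 1 / 2 ^ color_degree V c v)"
      using sum.subset_diff[OF psubset_imp_subset[OF MV] fin] by (metis add.commute)
    finally show ?thesis using sW by linarith
  next
    case False
    then have prime: "M = V" if "hmodule V c M" "2 \<le> card M" for M using that by auto
    have bound: "(\<Sum>v\<in>V. 1 / 2 ^ color_degree V c v) \<ge> (1 :: real)"
      if D: "\<And>v. v \<in> V \<Longrightarrow> color_degree V c v \<le> D" and "2 ^ D \<le> card V" for D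
    proof -
      have "(2::real) ^ D \<le> real (card V)" using that(2)
        by (metis of_nat_le_iff of_nat_numeral of_nat_power)
      then have "1 \<le> (\<Sum>v\<in>V. 1 / 2 ^ D :: real)" by (simp add: field_simps)
      also have "\<dots> \<le> (\<Sum>v\<in>V. 1 / 2 ^ color_degree V c v)"
        using D by (intro sum_mono divide_left_mono power_increasing) auto
      finally show ?thesis .
    qed
    \<comment> \<open>Degrees up to 2 would guarantee only 3/4 here. But two edges of a triangle
      agree, and the two vertices other than their common endpoint form a module.\<close>
    have "card V \<noteq> 3"
    proof
      assume "card V = 3"
      then obtain x y z where V: "V = {x, y, z}" "x \<noteq> y" "y \<noteq> z" "x \<noteq> z"
        by (auto simp: card_3_iff)
      have "\<not> hmodule V c {p, q}" if "p \<noteq> q" for p q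
      proof -
        have "card {p, q} = 2" using that by simp
        then show ?thesis using prime[of "{p, q}"] \<open>card V = 3\<close> by auto
      qed
      then have "\<not> hmodule V c {x, y}" "\<not> hmodule V c {y, z}" "\<not> hmodule V c {x, z}"
        using V(2-4) by auto
      then have "c {x, z} \<noteq> c {y, z}" "c {y, x} \<noteq> c {z, x}" "c {x, y} \<noteq> c {z, y}"
        using V by (auto simp: hmodule_def)
      then show False
        using gallai_coloringD[OF g, of x y z] V by (simp add: insert_commute)
    qed
    moreover have "card V \<ge> 1" using less.prems by (simp add: Suc_leI card_gt_0_iff)
    ultimately consider "card V = 1" | "card V = 2" | "card V \<ge> 4" by linarith
    then show ?thesis
    proof cases
      case 1
      then have "color_degree V c v \<le> 0" if "v \<in> V" for v
        using color_degree_less_card[OF fin that, of c] by linarith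
      then show ?thesis using bound[of 0] 1 by simp
    next
      case 2
      then have "color_degree V c v \<le> 1" if "v \<in> V" for v
        using color_degree_less_card[OF fin that, of c] by linarith
      then show ?thesis using bound[of 1] 2 by simp
    next
      case 3
      \<comment> \<open>A component containing an edge of colour \<open>k\<close> is a module with
        at least two vertices, hence all of \<open>V\<close>; so no occurring colour is
        disconnected.\<close>
      have "color_component V c k x = V" if k: "k \<in> c ` nsets V 2" and x: "x \<in> V" for k x
      proof -
        obtain p q where pq: "p \<in> V" "q \<in> V" "p \<noteq> q" "c {p, q} = k" using edge_of_color[OF k] .
        let ?C = "color_component V c k p"
        have "{p, q} \<subseteq> ?C"
          using color_component_step[of p V c k p q] color_component_refl[of p V c k] pq by simp
        then have "card {p, q} \<le> card ?C"
          using finite_subset[OF color_component_subset[OF pq(1)] fin] by (rule card_mono[rotated])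
        then have "?C = V" using prime[OF hmodule_color_component[OF g pq(1)]] pq by simp
        then show ?thesis using color_component_eq[of x V c k p] x by simp
      qed
      then have "card (c ` nsets V 2) \<le> 2"
        using exists_disconnected_color[OF fin g] by fastforce
      moreover have "color_degree V c v \<le> card (c ` nsets V 2)" for v
        unfolding color_degree_def using finite_imp_finite_nsets[OF fin]
        by (intro card_mono image_mono) auto
      ultimately have "color_degree V c v \<le> 2" for v using le_trans by blast
      then show ?thesis using bound[of 2] 3 by simp
    qed
  qed
qed

theorem theorem1p5:
  fixes n :: nat and c :: "nat set \<Rightarrow> 'c"
  assumes "n \<ge> 1"
    and "gallai_coloring {1..n} c"
  shows "(\<Sum>i = 1..n. 1 / 2 ^ color_degree {1..n} c i) \<ge> (1 :: real)"
  using assms by (intro gallai_coloring_sum_ge_1) auto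

end
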